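(* Let $n\ge 2$ and $\Omega=\{x\in\mathbb{R}^n:0<|x|<1\}$, so $\partial\Omega=\{|x|=1\}\cup\{0\}$. Then the Dirichlet problem \[ Q_\infty u=0\ \text{ in }\Omega,\qquad u(x)=x\ \text{ for }x\in\partial\Omega, \] admits infinitely many solutions $u\in C^\infty(\Omega;\mathbb{R}^n)\cap C^0(\overline\Omega;\mathbb{R}^n)$ with $\det Du\neq0$ on $\Omega$. More precisely, for every $\gamma>-1$ the map $u(x)=|x|^\gamma x$ (with $u(0)=0$) is such a solution and is a diffeomorphism of $\Omega$ onto itself.
   Context: Define the dilation $K:\mathbb{R}^{n\times n}\to[0,\infty]$ by $K(P)=|P|^2/\det(P^\top P)^{1/n}$ if $\operatorname{rk}(P)=n$ and $K(P)=+\infty$ otherwise, where $|P|^2=\sum_{\alpha,i}P_{\alpha i}^2$. $K$ is smooth on the open set of invertible matrices; write $K_P(P)\in\mathbb{R}^{n\times n}$ for the matrix of first partial derivatives $\partial K/\partial P_{\alpha i}$ and $K_{PP}$ for the second derivatives $\partial^2K/\partial P_{\alpha i}\partial P_{\beta j}$. For $u\in C^2(\Omega;\mathbb{R}^n)$ with $Du$ invertible everywhere, define \[ (Q_\infty u)_\alpha:=\sum_{i,j,\beta}\Big(K_{P_{\alpha i}}(Du)K_{P_{\beta j}}(Du)+\sum_{\gamma}[K_P(Du)]^\perp_{\alpha\gamma}K_{P_{\gamma i}P_{\beta j}}(Du)\Big)D^2_{ij}u_\beta, \] where $[K_P(Du(x))]^\perp$ is the orthogonal projection of $\mathbb{R}^n$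 onto the null space of $K_P(Du(x))^\top$. *)

theory Defs
  imports "HOL-Analysis.Analysis"
begin

definition pdiff :: "('a::euclidean_space \<Rightarrow> 'b::real_normed_vector) \<Rightarrow> 'a \<Rightarrow> 'a \<Rightarrow> 'b" where
  "pdiff f b x = frechet_derivative f (at x) b"

fun Ck :: "nat \<Rightarrow> 'a::euclidean_space set \<Rightarrow> ('a \<Rightarrow> 'b::real_normed_vector) \<Rightarrow> bool" where
  "Ck 0 S f = continuous_on S f"
| "Ck (Suc k) S f = ((\<forall>x\<in>S. f differentiable (at x)) \<and> continuous_on S f \<and>
      (\<forall>b\<in>Basis. Ck k S (pdiff f b)))"

definition smooth_on :: "'a::euclidean_space set \<Rightarrow> ('a \<Rightarrow> 'b::real_normed_vector) \<Rightarrow> bool" where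
  "smooth_on S f = (\<forall>k. Ck k S f)"

definition diffeomorphism_onto :: "'a::euclidean_space set \<Rightarrow> 'a set \<Rightarrow> ('a \<Rightarrow> 'a) \<Rightarrow> bool" where
  "diffeomorphism_onto S T f = (\<exists>g. homeomorphism S T f g \<and> smooth_on S f \<and> smooth_on T g)"

definition emat :: "'n::finite \<Rightarrow> 'n \<Rightarrow> real^'n^'n" where
  "emat a i = axis a (axis i 1)"

text \<open>The real-valued formula of the dilation (used on invertible matrices). norm is the Frobenius norm.\<close>
definition Kreal :: "real^'n::finite^'n \<Rightarrow> real" where
  "Kreal P = (norm P)^2 / (det (transpose P ** P)) powr (1 / real CARD('n))"

definition dilation :: "real^'n::finite^'n \<Rightarrow> ereal" where
  "dilation P = (if rank P = CARD('n) then ereal (Kreal P) else \<infinity>)"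

text \<open>First and second partial derivatives of K (on the open set of invertible matrices K = Kreal).\<close>
definition KP :: "real^'n::finite^'n \<Rightarrow> 'n \<Rightarrow> 'n \<Rightarrow> real" where
  "KP P a i = pdiff Kreal (emat a i) P"

definition KPP :: "real^'n::finite^'n \<Rightarrow> 'n \<Rightarrow> 'n \<Rightarrow> 'n \<Rightarrow> 'n \<Rightarrow> real" where
  "KPP P a i b j = pdiff (\<lambda>Q. pdiff Kreal (emat b j) Q) (emat a i) P"

definition perp_proj :: "real^'n::finite^'n \<Rightarrow> real^'n^'n" where
  "perp_proj A = (THE Pr. \<forall>v. transpose A *v (Pr *v v) = 0 \<and>
        (\<forall>w. transpose A *v w = 0 \<longrightarrow> (v - Pr *v v) \<bullet> w = 0))"

definition Du :: "(real^'n::finite \<Rightarrow> real^'n) \<Rightarrow> real^'n \<Rightarrow> real^'n^'n" where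
  "Du u x = (\<chi> a i. pdiff u (axis i 1) x $ a)"

definition D2u :: "(real^'n::finite \<Rightarrow> real^'n) \<Rightarrow> real^'n \<Rightarrow> 'n \<Rightarrow> 'n \<Rightarrow> 'n \<Rightarrow> real" where
  "D2u u x i j b = pdiff (pdiff u (axis j 1)) (axis i 1) x $ b"

definition KP_mat :: "real^'n::finite^'n \<Rightarrow> real^'n^'n" where
  "KP_mat P = (\<chi> a i. KP P a i)"

definition Qinf :: "(real^'n::finite \<Rightarrow> real^'n) \<Rightarrow> real^'n \<Rightarrow> real^'n" where
  "Qinf u x = (\<chi> a. \<Sum>i\<in>UNIV. \<Sum>j\<in>UNIV. \<Sum>b\<in>UNIV.
      (KP (Du u x) a i * KP (Du u x) b j
       + (\<Sum>c\<in>UNIV. perp_proj (KP_mat (Du u x)) $ a $ c * KPP (Du u x) c i b j))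
      * D2u u x i j b)"

definition punct_ball :: "(real^'n::finite) set" where
  "punct_ball = {x. 0 < norm x \<and> norm x < 1}"

definition is_solution :: "(real^'n::finite \<Rightarrow> real^'n) \<Rightarrow> bool" where
  "is_solution u = (smooth_on punct_ball u \<and> continuous_on (closure punct_ball) u \<and>
     (\<forall>x\<in>punct_ball. det (Du u x) \<noteq> 0) \<and>
     (\<forall>x\<in>punct_ball. Qinf u x = 0) \<and>
     (\<forall>x\<in>frontier punct_ball. u x = x))"

end

theory Submission
  imports Defs
begin

text \<open>
  For \<open>u x = |x|\<^sup>g x\<close> the gradient is a multiple of \<open>I + g e e\<^sup>T\<close> with \<open>e = x / |x|\<close>, and
  \<open>K\<^sub>P(Du) = \<kappa> ((g + n) / (1 + g) x x\<^sup>T - |x|\<^sup>2 I)\<close>, where \<open>\<kappa> = 0\<close> only for \<open>g = 0\<close>.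
  Contracting this matrix with the second derivatives of \<open>u\<close> gives \<open>0\<close> (the dilation of \<open>Du\<close> is
  constant), so the first part of the operator vanishes. For \<open>g \<noteq> 0\<close> and \<open>n \<ge> 2\<close> the matrix
  is invertible, so the projection in the second part is \<open>0\<close> and no second derivative of \<open>K\<close>
  is ever needed; for \<open>g = 0\<close> the second derivatives of \<open>u\<close> vanish.
\<close>

section \<open>Partial derivatives and the classes \<open>Ck\<close> on open sets\<close>

lemma pdiff_eq: "(f has_derivative f') (at x) \<Longrightarrow> pdiff f b x = f' b"
  by (metis frechet_derivative_at pdiff_def)

lemma pdiff_cong_open:
  assumes "open S" "x \<in> S" "\<And>y. y \<in> S \<Longrightarrow> f y = g y" "f differentiable (at x)"
  shows "pdiff g b x = pdiff f b x"
proof -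
  have "(f has_derivative frechet_derivative f (at x)) (at x)"
    using assms(4) frechet_derivative_works by blast
  then have "(g has_derivative frechet_derivative f (at x)) (at x)"
    using has_derivative_transform_within_open assms(1-3) by blast
  then show ?thesis
    by (metis pdiff_eq pdiff_def)
qed

lemma differentiable_cong_open:
  assumes "open S" "x \<in> S" "\<And>y. y \<in> S \<Longrightarrow> f y = g y" "f differentiable (at x)"
  shows "g differentiable (at x)"
  using assms has_derivative_transform_within_open unfolding differentiable_def by blast

text \<open>On an open set derivatives depend only on the values in the set. This lets the inductive
  steps below replace \<open>pdiff f b\<close> by a formula that is valid on \<open>S\<close>
  only.\<close>

lemma Ck_cong:
  assumes "open S" "\<And>y. y \<in> S \<Longrightarrow> f y = g y" "Ck k S f"
  shows "Ck k S g"
  using assms(2,3)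
proof (induction k arbitrary: f g)
  case 0
  then show ?case using continuous_on_cong by (metis Ck.simps(1))
next
  case (Suc k)
  have "Ck k S (pdiff g b)" if "b \<in> Basis" for b
    using Suc.IH[of "pdiff f b" "pdiff g b"] Suc.prems that
    by (simp add: pdiff_cong_open[OF assms(1) _ Suc.prems(1)])
  moreover have "\<forall>x\<in>S. g differentiable (at x)"
    using differentiable_cong_open[OF assms(1) _ Suc.prems(1)] Suc.prems(2) by auto
  moreover have "continuous_on S g"
    using Suc.prems continuous_on_cong by (metis Ck.simps(2))
  ultimately show ?case by simp
qed

lemma Ck_SucD: "Ck (Suc k) S f \<Longrightarrow> Ck k S f"
  by (induction k arbitrary: f) auto

lemma Ck_const: "Ck k S (\<lambda>x. c)"
proof (induction k arbitrary: c)
  case (Suc k)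
  have "pdiff (\<lambda>x::'a. c) b = (\<lambda>x. 0)" for b
    by (rule ext, rule pdiff_eq) (rule has_derivative_const)
  then show ?case using Suc by simp
qed simp

lemma Ck_bounded_linear:
  assumes "bounded_linear f"
  shows "Ck k S f"
proof (cases k)
  case 0
  then show ?thesis using assms by (simp add: linear_continuous_on)
next
  case (Suc k)
  have "pdiff f b = (\<lambda>x. f b)" for b
    by (rule ext, rule pdiff_eq) (rule bounded_linear_imp_has_derivative[OF assms])
  then show ?thesis
    using assms Suc bounded_linear_imp_differentiable by (auto simp: linear_continuous_on Ck_const)
qed

lemma Ck_add:
  assumes "open S" "Ck k S f" "Ck k S g"
  shows "Ck k S (\<lambda>x. f x + g x)"
  using assms(2,3)
proof (induction k arbitrary: f g)
  case 0
  then show ?case by (simp add: continuous_on_add)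
next
  case (Suc k)
  have "Ck k S (pdiff (\<lambda>x. f x + g x) b)" if "b \<in> Basis" for b
  proof (rule Ck_cong[OF assms(1)])
    show "Ck k S (\<lambda>x. pdiff f b x + pdiff g b x)"
      using Suc that by auto
    show "pdiff f b x + pdiff g b x = pdiff (\<lambda>x. f x + g x) b x" if "x \<in> S" for x
      using that Suc.prems unfolding pdiff_def
      by (subst frechet_derivative_at[symmetric, OF has_derivative_add])
         (auto simp: frechet_derivative_works[symmetric])
  qed
  then show ?case using Suc.prems by (auto intro: continuous_on_add)
qed

lemma Ck_scaleR:
  assumes "open S" "Ck k S f" "Ck k S g"
  shows "Ck k S (\<lambda>x. f x *\<^sub>R g x)"
  using assms(2,3)
proof (induction k arbitrary: f g)
  case 0
  then show ?case by (simp add: continuous_on_scaleR)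
next
  case (Suc k)
  have "Ck k S (pdiff (\<lambda>x. f x *\<^sub>R g x) b)" if "b \<in> Basis" for b
  proof (rule Ck_cong[OF assms(1)])
    \<comment> \<open>The product rule keeps undifferentiated factors, so \<open>f\<close> and
      \<open>g\<close> are also needed at order \<open>k\<close>.\<close>
    show "Ck k S (\<lambda>x. f x *\<^sub>R pdiff g b x + pdiff f b x *\<^sub>R g x)"
      using Suc.prems that Ck_SucD[OF Suc.prems(1)] Ck_SucD[OF Suc.prems(2)]
      by (auto intro!: Ck_add[OF assms(1)] Suc.IH)
    show "f x *\<^sub>R pdiff g b x + pdiff f b x *\<^sub>R g x = pdiff (\<lambda>x. f x *\<^sub>R g x) b x" if "x \<in> S" for x
      using that Suc.prems unfolding pdiff_def
      by (subst frechet_derivative_at[symmetric, OF has_derivative_scaleR])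
         (auto simp: frechet_derivative_works[symmetric])
  qed
  then show ?case using Suc.prems by (auto intro!: continuous_on_scaleR differentiable_scaleR)
qed

text \<open>Using the exponent \<open>a - 2\<close> and the linear form \<open>x \<bullet> h\<close>
  instead of \<open>sgn x\<close> keeps the derivative within powers of the norm times linear maps,
  so that it can be differentiated again by the same rule.\<close>

lemma has_derivative_norm_powr:
  fixes x :: "'a::real_inner"
  assumes "x \<noteq> 0"
  shows "((\<lambda>x. norm x powr a) has_derivative (\<lambda>h. a * norm x powr (a - 2) * (x \<bullet> h))) (at x)"
proof -
  \<comment> \<open>The general rule for \<open>powr\<close> also differentiates the exponent; the
    constant exponent contributes the term with \<open>ln\<close>.\<close>
  have eq: "norm x powr a * (0 * ln (norm x) + (sgn x \<bullet> h) * a / norm x)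
      = a * norm x powr (a - 2) * (x \<bullet> h)" for h
    using assms powr_add[of "norm x" "a - 2" 2]
    by (simp add: sgn_div_norm power2_eq_square field_simps)
  have "(norm has_derivative (\<lambda>h. sgn x \<bullet> h)) (at x)"
    using has_derivative_norm[OF assms] by (simp add: inner_commute)
  then have "((\<lambda>x. norm x powr a) has_derivative
      (\<lambda>h. norm x powr a * (0 * ln (norm x) + (sgn x \<bullet> h) * a / norm x))) (at x)"
    using has_derivative_powr[of norm "\<lambda>h. sgn x \<bullet> h" x UNIV "\<lambda>_. a" "\<lambda>_. 0"] assms
    by simp
  then show ?thesis
    by (simp only: eq)
qed

lemma Ck_norm_powr:
  assumes "open S" "0 \<notin> S"
  shows "Ck k S (\<lambda>x. norm x powr a)"
proof (induction k arbitrary: a)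
  case 0
  then show ?case using assms by (auto intro!: continuous_intros)
next
  case (Suc k)
  have "Ck k S (pdiff (\<lambda>x. norm x powr a) b)" for b
  proof (rule Ck_cong[OF assms(1)])
    show "Ck k S (\<lambda>x. norm x powr (a - 2) *\<^sub>R (a *\<^sub>R (x \<bullet> b)))"
      by (intro Ck_scaleR[OF assms(1)] Suc Ck_const Ck_bounded_linear bounded_linear_inner_left)
    show "norm x powr (a - 2) *\<^sub>R (a *\<^sub>R (x \<bullet> b)) = pdiff (\<lambda>x. norm x powr a) b x" if "x \<in> S" for x
      using that assms by (subst pdiff_eq[OF has_derivative_norm_powr]) auto
  qed
  moreover have "(\<lambda>x. norm x powr a) differentiable (at x)" if "x \<in> S" for x
    using has_derivative_norm_powr that assms unfolding differentiable_def by metis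
  ultimately show ?case using assms by (auto intro!: continuous_intros)
qed

section \<open>The radial map: smoothness, inverse and continuity\<close>

definition radial_power :: "real \<Rightarrow> 'a::real_normed_vector \<Rightarrow> 'a" where
  "radial_power g x = norm x powr g *\<^sub>R x"

lemma smooth_on_radial_power:
  assumes "open S" "0 \<notin> S"
  shows "smooth_on S (radial_power g)"
  unfolding smooth_on_def radial_power_def
  by (intro allI Ck_scaleR assms Ck_norm_powr Ck_bounded_linear bounded_linear_ident)

lemma norm_radial_power: "norm (radial_power g x) = norm x powr (1 + g)"
  by (cases "x = 0") (simp_all add: radial_power_def powr_add)

text \<open>Directions are kept and norms are raised to the power \<open>1 + g\<close>, so
  composition multiplies these exponents.\<close>

lemma radial_power_radial_power:
  assumes "(1 + g) * (1 + h) = 1"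
  shows "radial_power h (radial_power g x) = x"
proof (cases "x = 0")
  case False
  have "norm x powr ((1 + g) * h + g) = 1"
    using assms False by (simp add: algebra_simps)
  then have "(norm x powr (1 + g)) powr h * norm x powr g = 1"
    by (simp only: powr_powr powr_add[of _ "(1 + g) * h" g])
  moreover have "radial_power h (radial_power g x)
      = ((norm x powr (1 + g)) powr h * norm x powr g) *\<^sub>R x"
    using norm_radial_power[of g x] by (simp only: radial_power_def scaleR_scaleR)
  ultimately show ?thesis
    by simp
qed (simp add: radial_power_def)

text \<open>Only the origin is delicate: the norm of the image is a power of \<open>norm x\<close>
  with exponent \<open>1 + g\<close>, and positivity of this exponent makes it tend to 0.\<close>

lemma continuous_on_radial_power:
  assumes "g > -1"
  shows "continuous_on S (radial_power g)"
proof -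
  have "isCont (radial_power g) x" for x :: 'a
  proof (cases "x = 0")
    case True
    have "((\<lambda>x::'a. norm x powr (1 + g)) \<longlongrightarrow> norm (0::'a) powr (1 + g)) (at 0)"
      using assms by (intro tendsto_powr' tendsto_intros) auto
    then have "((\<lambda>x::'a. norm (radial_power g x)) \<longlongrightarrow> 0) (at 0)"
      using assms by (simp add: norm_radial_power)
    then show ?thesis
      using True tendsto_norm_zero_cancel[of "radial_power g"]
      by (simp add: isCont_def radial_power_def[of _ 0])
  next
    case False
    then show ?thesis
      unfolding radial_power_def by (intro continuous_intros) auto
  qed
  then show ?thesis
    by (simp add: continuous_at_imp_continuous_on)
qed

section \<open>The punctured ball: self-diffeomorphism and boundary\<close>

lemma open_punct_ball: "open punct_ball"
  unfolding punct_ball_def by (intro open_Collect_conj open_Collect_less continuous_intros)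

lemma radial_power_in_punct_ball:
  assumes "g > -1" "x \<in> punct_ball"
  shows "radial_power g x \<in> punct_ball"
proof -
  have "0 < norm x powr (1 + g)" "norm x powr (1 + g) < 1"
    using assms powr_less_mono2[of "1 + g" "norm x" 1] by (auto simp: punct_ball_def)
  then show ?thesis
    unfolding punct_ball_def by (simp only: norm_radial_power mem_Collect_eq simp_thms)
qed

lemma diffeomorphism_radial_power:
  assumes "g > -1"
  shows "diffeomorphism_onto punct_ball punct_ball (radial_power g)"
proof -
  \<comment> \<open>This solves \<open>(1 + g) * (1 + h) = 1\<close>; then \<open>1 + h\<close> is
    the reciprocal of a positive number, so the inverse map belongs to the same family.\<close>
  define h where "h = - g / (1 + g)"
  have h: "(1 + g) * (1 + h) = 1" "(1 + h) * (1 + g) = 1" "h > -1"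
    using assms by (auto simp: h_def field_simps)
  have "homeomorphism punct_ball punct_ball (radial_power g) (radial_power h)"
    by (rule homeomorphismI)
      (use assms h in \<open>auto simp: radial_power_radial_power radial_power_in_punct_ball
        intro!: continuous_on_radial_power\<close>)
  moreover have "smooth_on punct_ball (radial_power g)" for g
    by (rule smooth_on_radial_power[OF open_punct_ball]) (simp add: punct_ball_def)
  ultimately show ?thesis
    unfolding diffeomorphism_onto_def by blast
qed

text \<open>This inclusion suffices for the boundary condition, since the radial map fixes the
  origin and all unit vectors.\<close>

lemma frontier_punct_ball: "x \<in> frontier punct_ball \<Longrightarrow> x = 0 \<or> norm x = 1"
proof -
  assume x: "x \<in> frontier punct_ball"
  have "closure punct_ball \<subseteq> cball 0 1"
    by (rule closure_minimal) (auto simp: punct_ball_def)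
  moreover have "x \<in> closure punct_ball" "x \<notin> punct_ball"
    using x interior_open[OF open_punct_ball] by (auto simp: frontier_def)
  ultimately show ?thesis
    by (force simp: punct_ball_def)
qed

section \<open>First and second derivatives of the radial map\<close>

lemma axis_nth: "axis i c $ k = (if k = i then c else 0)"
  by (simp add: axis_def)

lemma has_derivative_radial_power:
  fixes x :: "'a::real_inner"
  assumes "x \<noteq> 0"
  shows "(radial_power g has_derivative
    (\<lambda>h. norm x powr g *\<^sub>R h + (g * norm x powr (g - 2) * (x \<bullet> h)) *\<^sub>R x)) (at x)"
  unfolding radial_power_def
  by (rule has_derivative_scaleR[OF has_derivative_norm_powr[OF assms] has_derivative_ident])

lemma Du_radial_power:
  fixes x :: "real^'n"
  assumes "x \<noteq> 0"
  shows "Du (radial_power g) x $ a $ i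
    = norm x powr (g - 2) * ((x \<bullet> x) * (if a = i then 1 else 0) + g * x $ a * x $ i)"
proof -
  have "norm x powr g = norm x powr (g - 2) * (x \<bullet> x)"
    using assms powr_add[of "norm x" "g - 2" 2] by (simp add: power2_norm_eq_inner)
  then show ?thesis
    unfolding Du_def
    by (simp add: pdiff_eq[OF has_derivative_radial_power[OF assms]] inner_axis
        axis_nth algebra_simps)
qed

text \<open>After the common power of the norm is pulled out, the bracket is symmetric in all three
  indices, which keeps the later contractions short.\<close>

lemma D2u_radial_power:
  fixes x :: "real^'n"
  assumes "x \<noteq> 0"
  shows "D2u (radial_power g) x i j b = g * norm x powr (g - 2) *
    (x $ i * (if b = j then 1 else 0) + x $ j * (if b = i then 1 else 0)
      + x $ b * (if i = j then 1 else 0) + (g - 2) / (x \<bullet> x) * x $ i * x $ j * x $ b)"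
proof -
  define e :: "real^'n" where "e = axis j 1"
  define D where "D h = (g * norm x powr (g - 2) * (x \<bullet> h)) *\<^sub>R e
    + ((g * norm x powr (g - 2) * (x \<bullet> e)) *\<^sub>R h
      + (g * norm x powr (g - 2) * (h \<bullet> e)
        + g * ((g - 2) * norm x powr (g - 2 - 2) * (x \<bullet> h)) * (x \<bullet> e)) *\<^sub>R x)" for h
  have "((\<lambda>y. norm y powr g *\<^sub>R e + (g * norm y powr (g - 2) * (y \<bullet> e)) *\<^sub>R y)
      has_derivative D) (at x)"
    unfolding D_def
    by (rule derivative_eq_intros has_derivative_norm_powr assms refl ext)+
      (simp add: algebra_simps)
  \<comment> \<open>The closed formula for the first derivative holds on the open complement of the
    origin, which is enough to differentiate it at \<open>x\<close>.\<close>
  then have "(pdiff (radial_power g) e has_derivative D) (at x)"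
    by (rule has_derivative_transform_within_open[of _ _ _ _ "- {0}"])
      (use assms in \<open>auto simp: pdiff_eq[OF has_derivative_radial_power]\<close>)
  then have "D2u (radial_power g) x i j b = D (axis i 1) $ b"
    unfolding D2u_def by (simp add: pdiff_eq e_def)
  moreover have "norm x powr (g - 2 - 2) = norm x powr (g - 2) / (x \<bullet> x)"
    using assms powr_diff[of "norm x" "g - 2" 2] by (simp add: power2_norm_eq_inner)
  ultimately show ?thesis
    by (simp only: D_def e_def)
       (auto simp: inner_axis inner_axis_axis axis_nth algebra_simps)
qed

section \<open>Derivatives of the determinant and of the dilation; the projection\<close>

lemma differentiable_det: "(det :: real^'n^'n \<Rightarrow> real) differentiable (at P)"
  unfolding det_def differentiable_def
  by (rule exI)
     (rule derivative_eq_intros bounded_linear.has_derivative[OF bounded_linear_vec_nth] refl | simp)+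

text \<open>Jacobi's formula in the direction of a matrix unit. Only row \<open>a\<close> is
  perturbed, so the determinant is affine along this line; its slope is a cofactor, found by
  Cramer's rule.\<close>

lemma pdiff_det:
  fixes P Q :: "real^'n^'n"
  assumes "Q ** P = mat 1"
  shows "pdiff det (emat a i) P = det P * Q $ i $ a"
proof -
  obtain D where D: "(det has_derivative D) (at P)"
    using differentiable_det differentiable_def by blast
  have "(\<Sum>k\<in>UNIV. Q $ i $ k * P $ k $ j) = (if i = j then 1 else 0)" for j
    using assms by (simp add: vec_eq_iff matrix_matrix_mult_def mat_def)
  \<comment> \<open>Row \<open>i\<close> of \<open>Q ** P = mat 1\<close> writes the unit vector as
    a combination of the rows of \<open>P\<close>, as Cramer's rule for the transpose
    requires.\<close>
  then have "axis i 1 = (\<Sum>k\<in>UNIV. Q $ i $ k *s row k P)"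
    by (simp add: vec_eq_iff axis_def row_def axis_nth eq_commute)
  then have c: "det (\<chi> k. if k = a then axis i 1 else row k P) = Q $ i $ a * det P"
    by (simp only: cramer_lemma_transpose)
  have "det (P + t *\<^sub>R emat a i) = det P + t * (Q $ i $ a * det P)" for t
  proof -
    have "P + t *\<^sub>R emat a i = (\<chi> k. if k = a then row a P + t *s axis i 1 else row k P)"
      by (auto simp: vec_eq_iff emat_def axis_def row_def)
    moreover have "(\<chi> k. if k = a then row a P else row k P) = P"
      by (auto simp: vec_eq_iff row_def)
    ultimately show ?thesis
      using det_row_add[of a "\<lambda>k. row a P" "\<lambda>k. t *s axis i 1" "\<lambda>k. row k P"]
        det_row_mul[of a t "\<lambda>k. axis i 1" "\<lambda>k. row k P"] c by simp
  qed
  \<comment> \<open>The same derivative along the line is computed from the affine formula and from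
    the chain rule; uniqueness, evaluated at 1, identifies \<open>D\<close> on the matrix
    unit.\<close>
  then have "((\<lambda>t. det (P + t *\<^sub>R emat a i)) has_derivative (\<lambda>t. t * (Q $ i $ a * det P))) (at 0)"
    by (auto intro!: derivative_eq_intros)
  moreover have "((\<lambda>t. det (P + t *\<^sub>R emat a i)) has_derivative (\<lambda>t. D (t *\<^sub>R emat a i))) (at 0)"
    by (rule has_derivative_compose[of "\<lambda>t. P + t *\<^sub>R emat a i" _ 0 UNIV det D])
      (auto intro!: derivative_eq_intros D)
  ultimately have "D (1 *\<^sub>R emat a i) = 1 * (Q $ i $ a * det P)"
    using has_derivative_unique by metis
  then show ?thesis
    by (simp add: pdiff_eq[OF D])
qed

text \<open>The product rule for \<open>(P \<bullet> P) * (det P ^ 2) powr (- 1 / n)\<close>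
  combined with Jacobi's formula. Squaring the determinant keeps the base of \<open>powr\<close>
  positive whatever its sign.\<close>

lemma KP_eq:
  fixes P Q :: "real^'n^'n"
  assumes "Q ** P = mat 1"
  shows "KP P a i = 2 / (det P ^ 2) powr (1 / real CARD('n))
    * (P $ a $ i - (P \<bullet> P) / real CARD('n) * Q $ i $ a)"
proof -
  define n where "n = real CARD('n)"
  have "det Q * det P = 1"
    using assms det_mul[of Q P] by (simp add: det_I)
  then have nz: "det P \<noteq> 0"
    by auto
  obtain D where D: "(det has_derivative D) (at P)"
    using differentiable_det differentiable_def by blast
  have Kreal: "Kreal = (\<lambda>P::real^'n^'n. (P \<bullet> P) * (det P ^ 2) powr (- 1 / n))"
    by (rule ext) (simp add: Kreal_def n_def det_mul det_transpose power2_norm_eq_inner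
        powr_minus_divide flip: power2_eq_square)
  have "(Kreal has_derivative (\<lambda>H. 2 * (P \<bullet> H) * (det P ^ 2) powr (- 1 / n)
      + (P \<bullet> P) * ((det P ^ 2) powr (- 1 / n) * (2 * det P * D H * (- 1 / n) / det P ^ 2)))) (at P)"
    unfolding Kreal using nz
    by (auto intro!: derivative_eq_intros D simp: inner_commute)
  then have "KP P a i = 2 * (P \<bullet> emat a i) * (det P ^ 2) powr (- 1 / n)
      + (P \<bullet> P) * ((det P ^ 2) powr (- 1 / n) * (2 * det P * D (emat a i) * (- 1 / n) / det P ^ 2))"
    unfolding KP_def by (rule pdiff_eq)
  moreover have "D (emat a i) = det P * Q $ i $ a"
    using pdiff_det[OF assms] pdiff_eq[OF D] by metis
  moreover have "P \<bullet> emat a i = P $ a $ i"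
    by (simp add: emat_def inner_axis)
  ultimately show ?thesis
    using nz by (simp add: n_def[symmetric] powr_minus_divide power2_eq_square field_simps)
qed

text \<open>Since \<open>perp_proj\<close> is a definite description, uniqueness is needed too: any
  candidate maps into the null space of \<open>transpose A\<close>, which is trivial.\<close>

lemma perp_proj_eq_0:
  assumes "\<And>w. transpose A *v w = 0 \<Longrightarrow> w = 0"
  shows "perp_proj A = 0"
  unfolding perp_proj_def
proof (rule the_equality)
  show "\<forall>v. transpose A *v (0 *v v) = 0 \<and> (\<forall>w. transpose A *v w = 0 \<longrightarrow> (v - 0 *v v) \<bullet> w = 0)"
    using assms by fastforce
  fix Pr assume "\<forall>v. transpose A *v (Pr *v v) = 0 \<and>
        (\<forall>w. transpose A *v w = 0 \<longrightarrow> (v - Pr *v v) \<bullet> w = 0)"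
  then have "Pr *v v = 0 *v v" for v
    using assms by simp
  then show "Pr = 0"
    by (simp add: matrix_eq)
qed

section \<open>Inverse and norm of the gradient, and the resulting \<open>KP\<close>\<close>

lemma sum_sq_eq_inner: "(\<Sum>k\<in>UNIV. x $ k * x $ k) = x \<bullet> (x::real^'n)"
  by (simp add: inner_vec_def)

text \<open>The Sherman-Morrison formula for a rank-one perturbation of a multiple of the identity;
  it requires \<open>1 + g\<close> to be nonzero.\<close>

lemma Du_radial_power_left_inverse:
  fixes x :: "real^'n"
  assumes "x \<noteq> 0" "g > -1"
  shows "(\<chi> i a. 1 / (norm x powr (g - 2) * (x \<bullet> x)) *
     ((if a = i then 1 else 0) - g / ((1 + g) * (x \<bullet> x)) * x $ a * x $ i))
    ** Du (radial_power g) x = mat 1"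
proof -
  define R where "R = norm x powr (g - 2)"
  define \<rho> where "\<rho> = x \<bullet> x"
  define s where "s = 1 + g"
  have nz: "R \<noteq> 0" "\<rho> \<noteq> 0" "s \<noteq> 0" and g: "g = s - 1"
    using assms by (auto simp: R_def \<rho>_def s_def)
  have "(\<Sum>k\<in>UNIV. (1 / (R * \<rho>) * ((if k = i then 1 else 0) - g / (s * \<rho>) * x $ k * x $ i))
      * (R * (\<rho> * (if k = j then 1 else 0) + g * x $ k * x $ j)))
    = (if i = j then 1 else 0)" (is "sum ?f UNIV = _") for i j
  proof -
    \<comment> \<open>The coefficient of \<open>x $ k * x $ k\<close> once the Kronecker terms are
      split off. Naming it keeps it opaque, so that it can be pulled out of the sum; the same device
      recurs below.\<close>
    define C where "C = g\<^sup>2 / (s * \<rho>\<^sup>2) * x $ i * x $ j"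
    have "?f k = (if k = i then (if k = j then 1 else 0) + g / \<rho> * x $ k * x $ j else 0)
        - (if k = j then g / (s * \<rho>) * x $ k * x $ i else 0)
        - C * (x $ k * x $ k)" for k
      using nz by (auto simp: C_def field_simps power2_eq_square)
    then have "sum ?f UNIV = (if i = j then 1 else 0) + g / \<rho> * x $ i * x $ j
        - g / (s * \<rho>) * x $ j * x $ i - C * \<rho>"
      by (simp add: sum_subtractf sum_sq_eq_inner \<rho>_def flip: sum_distrib_left)
    also have "\<dots> = (if i = j then 1 else 0)"
      using nz unfolding C_def g by (auto simp: field_simps power2_eq_square)
    finally show ?thesis .
  qed
  then show ?thesis
    by (simp add: vec_eq_iff matrix_matrix_mult_def mat_def Du_radial_power[OF assms(1)]
        flip: R_def \<rho>_def s_def)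
qed

lemma det_Du_radial_power:
  fixes x :: "real^'n"
  assumes "x \<noteq> 0" "g > -1"
  shows "det (Du (radial_power g) x) \<noteq> 0"
  using Du_radial_power_left_inverse[OF assms] invertible_det_nz invertible_left_inverse by blast

text \<open>Up to the scalar factor, the symmetric gradient has eigenvalue 1 with multiplicity
  \<open>n - 1\<close> and the simple eigenvalue \<open>1 + g\<close>; the squares add up to
  \<open>n + 2 * g + g\<^sup>2\<close>.\<close>

lemma inner_Du_radial_power:
  fixes x :: "real^'n"
  assumes "x \<noteq> 0"
  shows "Du (radial_power g) x \<bullet> Du (radial_power g) x
    = (norm x powr (g - 2) * (x \<bullet> x))\<^sup>2 * (real CARD('n) + 2 * g + g\<^sup>2)"
proof -
  define R where "R = norm x powr (g - 2)"
  define \<rho> where "\<rho> = x \<bullet> x"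
  define D where "D a i = R * (\<rho> * (if a = i then 1 else 0) + g * x $ a * x $ i)" for a i
  have "D a i * D a i = (if i = a then R\<^sup>2 * \<rho>\<^sup>2 + 2 * g * R\<^sup>2 * \<rho> * (x $ a * x $ a) else 0)
      + R\<^sup>2 * g\<^sup>2 * (x $ a * x $ a) * (x $ i * x $ i)" for a i
    by (auto simp: D_def algebra_simps power2_eq_square)
  then have "(\<Sum>a\<in>UNIV. \<Sum>i\<in>UNIV. D a i * D a i)
      = real CARD('n) * (R\<^sup>2 * \<rho>\<^sup>2) + 2 * g * R\<^sup>2 * \<rho> * \<rho> + R\<^sup>2 * g\<^sup>2 * \<rho> * \<rho>"
    by (simp add: sum.distrib sum_sq_eq_inner \<rho>_def
        flip: sum_distrib_left sum_distrib_right)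
  also have "(\<Sum>a\<in>UNIV. \<Sum>i\<in>UNIV. D a i * D a i)
      = Du (radial_power g) x \<bullet> Du (radial_power g) x"
  proof -
    have "P \<bullet> P = (\<Sum>a\<in>UNIV. \<Sum>i\<in>UNIV. P $ a $ i * P $ a $ i)" for P :: "real^'n^'n"
      by (simp add: inner_vec_def)
    then show ?thesis
      by (simp only: Du_radial_power[OF assms] D_def R_def \<rho>_def)
  qed
  finally show ?thesis
    by (simp add: algebra_simps power2_eq_square flip: R_def \<rho>_def)
qed

text \<open>The scalar \<kappa> stays hidden because the later arguments use at most that it is
  nonzero for nonzero \<open>g\<close>.\<close>

lemma KP_Du_radial_power:
  fixes x :: "real^'n"
  assumes "x \<noteq> 0" "g > -1"
  obtains \<kappa> where "g \<noteq> 0 \<Longrightarrow> \<kappa> \<noteq> 0"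
    "\<And>a i. KP (Du (radial_power g) x) a i =
      \<kappa> * ((g + real CARD('n)) / (1 + g) * x $ a * x $ i - (x \<bullet> x) * (if a = i then 1 else 0))"
proof -
  define R where "R = norm x powr (g - 2)"
  define \<rho> where "\<rho> = x \<bullet> x"
  define s where "s = 1 + g"
  define n where "n = real CARD('n)"
  define d where "d = (det (Du (radial_power g) x) ^ 2) powr (1 / n)"
  \<comment> \<open>Read off from the identity part, where
    \<open>1 - (n + 2 * g + g\<^sup>2) / n = - g * (2 + g) / n\<close>. The factor
    \<open>2 + g\<close> is positive.\<close>
  define \<kappa> where "\<kappa> = 2 * R * g * (2 + g) / (n * d)"
  have nz: "R \<noteq> 0" "\<rho> \<noteq> 0" "s \<noteq> 0" "n \<noteq> 0" "d \<noteq> 0" and g: "g = s - 1"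
    using assms det_Du_radial_power[OF assms] by (auto simp: R_def \<rho>_def s_def n_def d_def)
  have "KP (Du (radial_power g) x) a i =
      \<kappa> * ((g + n) / s * x $ a * x $ i - \<rho> * (if a = i then 1 else 0))" for a i
  proof -
    have "KP (Du (radial_power g) x) a i = 2 / d * (R * (\<rho> * (if a = i then 1 else 0) + g * x $ a * x $ i)
        - ((R * \<rho>)\<^sup>2 * (n + 2 * g + g\<^sup>2)) / n * (1 / (R * \<rho>) *
     ((if a = i then 1 else 0) - g / (s * \<rho>) * x $ a * x $ i)))"
      by (simp add: KP_eq[OF Du_radial_power_left_inverse[OF assms]] inner_Du_radial_power[OF assms(1)]
          Du_radial_power[OF assms(1)] flip: R_def \<rho>_def s_def n_def d_def)
    also have "\<dots> = \<kappa> * ((g + n) / s * x $ a * x $ i - \<rho> * (if a = i then 1 else 0))"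
      using nz unfolding \<kappa>_def g by (auto simp: field_simps power2_eq_square)
    finally show ?thesis .
  qed
  moreover have "g \<noteq> 0 \<Longrightarrow> \<kappa> \<noteq> 0"
    using nz assms by (auto simp: \<kappa>_def)
  ultimately show ?thesis
    unfolding \<rho>_def s_def n_def by (rule that[rotated])
qed

section \<open>Vanishing of both parts of the operator\<close>

lemma KP_D2u_radial_power:
  fixes x :: "real^'n"
  assumes "x \<noteq> 0" "g > -1"
  shows "(\<Sum>j\<in>UNIV. \<Sum>b\<in>UNIV. KP (Du (radial_power g) x) b j * D2u (radial_power g) x i j b) = 0"
proof -
  define n where "n = real CARD('n)"
  define c where "c = (g + n) / (1 + g)"
  define \<rho> where "\<rho> = x \<bullet> x"
  define A where "A j b = x $ i * (if b = j then 1 else 0) + x $ j * (if b = i then 1 else 0)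
      + x $ b * (if i = j then 1 else 0) + (g - 2) / \<rho> * x $ i * x $ j * x $ b" for j b
  obtain \<kappa> where KP: "KP (Du (radial_power g) x) b j =
      \<kappa> * (c * x $ b * x $ j - \<rho> * (if b = j then 1 else 0))" for b j
    using KP_Du_radial_power[OF assms] unfolding c_def n_def \<rho>_def by metis
  have D2u: "D2u (radial_power g) x i j b = g * norm x powr (g - 2) * A j b" for j b
    by (simp only: D2u_radial_power[OF assms(1)] A_def \<rho>_def)
  have \<rho>: "\<rho> \<noteq> 0"
    using assms by (simp add: \<rho>_def)
  \<comment> \<open>By linearity it is enough to contract the bracket \<open>A\<close> with the
    identity and with the rank-one matrix of \<open>x\<close>, the two ingredients of
    \<open>KP\<close>.\<close>
  have 1: "(\<Sum>j\<in>UNIV. \<Sum>b\<in>UNIV. (if b = j then 1 else 0) * A j b) = (n + g) * x $ i"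
  proof -
    define C where "C = (g - 2) / \<rho> * x $ i"
    have "(\<Sum>j\<in>UNIV. \<Sum>b\<in>UNIV. (if b = j then 1 else 0) * A j b) = (\<Sum>j\<in>UNIV. A j j)"
      by (simp add: if_distrib[of "\<lambda>t. t * _"] cong: if_cong)
    also have "\<dots> = n * x $ i + 2 * x $ i + C * \<rho>"
    proof -
      have "A j j = x $ i + (if j = i then 2 * x $ j else 0) + C * (x $ j * x $ j)" for j
        by (simp add: A_def C_def)
      then show ?thesis
        by (simp add: sum.distrib sum_sq_eq_inner \<rho>_def n_def flip: sum_distrib_left)
    qed
    finally show ?thesis
      using \<rho> by (simp add: C_def field_simps)
  qed
  have 2: "(\<Sum>j\<in>UNIV. \<Sum>b\<in>UNIV. x $ b * x $ j * A j b) = (1 + g) * \<rho> * x $ i"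
  proof -
    have "(\<Sum>b\<in>UNIV. x $ b * x $ j * A j b) = 2 * x $ i * (x $ j * x $ j)
        + (if i = j then \<rho> * x $ j else 0) + (g - 2) * x $ i * (x $ j * x $ j)" for j
    proof -
      define C where "C = (g - 2) / \<rho> * x $ i * x $ j * x $ j"
      have "x $ b * x $ j * A j b = (if b = j then x $ i * x $ j * x $ b else 0)
          + (if b = i then x $ j * x $ j * x $ b else 0)
          + (if i = j then x $ j else 0) * (x $ b * x $ b)
          + C * (x $ b * x $ b)" for b
        by (simp add: A_def C_def algebra_simps)
      then have "(\<Sum>b\<in>UNIV. x $ b * x $ j * A j b) = x $ i * x $ j * x $ j + x $ j * x $ j * x $ i
          + (if i = j then x $ j else 0) * \<rho> + C * \<rho>"
        by (simp add: sum.distrib sum_sq_eq_inner \<rho>_def flip: sum_distrib_left)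
      then show ?thesis
        using \<rho> by (simp add: C_def field_simps)
    qed
    then have "(\<Sum>j\<in>UNIV. \<Sum>b\<in>UNIV. x $ b * x $ j * A j b)
        = 2 * x $ i * \<rho> + \<rho> * x $ i + (g - 2) * x $ i * \<rho>"
      by (simp add: sum.distrib sum_sq_eq_inner \<rho>_def flip: sum_distrib_left)
    then show ?thesis
      by (simp add: algebra_simps)
  qed
  have "(\<Sum>j\<in>UNIV. \<Sum>b\<in>UNIV. KP (Du (radial_power g) x) b j * D2u (radial_power g) x i j b)
      = (\<Sum>j\<in>UNIV. \<Sum>b\<in>UNIV. \<kappa> * g * norm x powr (g - 2) *
          (c * (x $ b * x $ j * A j b) - \<rho> * ((if b = j then 1 else 0) * A j b)))"
    by (intro sum.cong refl) (simp add: KP D2u algebra_simps)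
  also have "\<dots> = \<kappa> * g * norm x powr (g - 2) *
      (c * ((1 + g) * \<rho> * x $ i) - \<rho> * ((n + g) * x $ i))"
    by (simp only: 1 2 sum_subtractf flip: sum_distrib_left)
  \<comment> \<open>The two contractions cancel because \<open>c * (1 + g) = g + n\<close>.\<close>
  also have "\<dots> = 0"
    using assms by (simp add: c_def)
  finally show ?thesis .
qed

text \<open>A null vector \<open>w\<close> satisfies \<open>(c * (x \<bullet> w)) *\<^sub>R x = (x
  \<bullet> x) *\<^sub>R w\<close>. Pairing with \<open>x\<close> forces
  \<open>x \<bullet> w = 0\<close> when \<open>c\<close> differs from 1, and then
  \<open>w = 0\<close>.\<close>

lemma perp_proj_Du_radial_power:
  fixes x :: "real^'n"
  assumes "x \<noteq> 0" "g > -1" "g \<noteq> 0" "CARD('n) \<ge> 2"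
  shows "perp_proj (KP_mat (Du (radial_power g) x)) = 0"
proof (rule perp_proj_eq_0)
  fix w :: "real^'n"
  assume w: "transpose (KP_mat (Du (radial_power g) x)) *v w = 0"
  define n where "n = real CARD('n)"
  define c where "c = (g + n) / (1 + g)"
  \<comment> \<open>Equality would mean \<open>g + n = 1 + g\<close>, that is \<open>n = 1\<close>;
    this is where dimension at least 2 enters.\<close>
  have "c \<noteq> 1"
    using assms by (simp add: c_def n_def field_simps)
  obtain \<kappa> where \<kappa>: "\<kappa> \<noteq> 0" and KP: "KP (Du (radial_power g) x) a i =
      \<kappa> * (c * x $ a * x $ i - (x \<bullet> x) * (if a = i then 1 else 0))" for a i
    using KP_Du_radial_power[OF assms(1,2)] assms(3) unfolding c_def n_def by metis
  have "(transpose (KP_mat (Du (radial_power g) x)) *v w) $ i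
      = \<kappa> * (c * (x \<bullet> w) * x $ i - (x \<bullet> x) * w $ i)" for i
  proof -
    define C where "C = \<kappa> * c * x $ i"
    have "(transpose (KP_mat (Du (radial_power g) x)) *v w) $ i
        = (\<Sum>a\<in>UNIV. C * (x $ a * w $ a) - (if a = i then \<kappa> * (x \<bullet> x) * w $ a else 0))"
      unfolding matrix_vector_mult_def transpose_def KP_mat_def
      by (auto simp: KP C_def algebra_simps intro!: sum.cong)
    then show ?thesis
      by (simp add: sum_subtractf inner_vec_def[of x w] flip: sum_distrib_left)
        (simp add: C_def algebra_simps)
  qed
  then have "c * (x \<bullet> w) * x $ i = (x \<bullet> x) * w $ i" for i
    using w \<kappa> by simp
  then have eq: "(c * (x \<bullet> w)) *\<^sub>R x = (x \<bullet> x) *\<^sub>R w"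
    by (simp add: vec_eq_iff)
  then have "(x \<bullet> x) * (c * (x \<bullet> w)) = (x \<bullet> x) * (x \<bullet> w)"
    by (metis inner_scaleR_right mult.commute)
  then have "x \<bullet> w = 0"
    using assms(1) \<open>c \<noteq> 1\<close> by simp
  then show "w = 0"
    using eq assms(1) by simp
qed

lemma Qinf_radial_power:
  fixes x :: "real^'n"
  assumes "x \<noteq> 0" "g > -1" "CARD('n) \<ge> 2"
  shows "Qinf (radial_power g) x = 0"
proof (cases "g = 0")
  case True
  then show ?thesis
    by (simp add: Qinf_def vec_eq_iff D2u_radial_power[OF assms(1)])
next
  case False
  have "Qinf (radial_power g) x = (\<chi> a. \<Sum>i\<in>UNIV. KP (Du (radial_power g) x) a i *
      (\<Sum>j\<in>UNIV. \<Sum>b\<in>UNIV. KP (Du (radial_power g) x) b j * D2u (radial_power g) x i j b))"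
    by (simp add: Qinf_def perp_proj_Du_radial_power[OF assms(1,2) False assms(3)]
        sum_distrib_left mult.assoc)
  then show ?thesis
    by (simp add: KP_D2u_radial_power[OF assms(1,2)] vec_eq_iff)
qed

section \<open>The infinite family of solutions\<close>

lemma is_solution_radial_power:
  assumes "g > -1" "CARD('n) \<ge> 2"
  shows "is_solution (radial_power g :: real^'n \<Rightarrow> real^'n)"
  unfolding is_solution_def
proof (intro conjI ballI)
  show "smooth_on punct_ball (radial_power g :: real^'n \<Rightarrow> real^'n)"
    by (rule smooth_on_radial_power[OF open_punct_ball]) (simp add: punct_ball_def)
  show "continuous_on (closure punct_ball) (radial_power g :: real^'n \<Rightarrow> real^'n)"
    using assms by (intro continuous_on_radial_power)
  fix x :: "real^'n"
  show "det (Du (radial_power g) x) \<noteq> 0" if "x \<in> punct_ball"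
    using that assms by (intro det_Du_radial_power) (auto simp: punct_ball_def)
  show "Qinf (radial_power g) x = 0" if "x \<in> punct_ball"
    using that assms by (intro Qinf_radial_power) (auto simp: punct_ball_def)
  show "radial_power g x = x" if "x \<in> frontier punct_ball"
    using frontier_punct_ball[OF that] by (auto simp: radial_power_def)
qed

text \<open>The maps are compared as functions on the whole space, at a vector of norm 2: powers of
  a base other than 1 determine their exponent. Norm 1/2 would separate them inside the ball in the
  same way.\<close>

lemma inj_radial_power: "inj (radial_power :: real \<Rightarrow> real^'n \<Rightarrow> real^'n)"
proof (rule injI)
  fix g h :: real
  assume eq: "(radial_power g :: real^'n \<Rightarrow> real^'n) = radial_power h"
  obtain x :: "real^'n" where x: "norm x = 2"
    using vector_choose_size[of 2] by auto
  then have "2 powr (1 + g) = (2::real) powr (1 + h)"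
    using eq norm_radial_power[of g x] norm_radial_power[of h x] by metis
  then show "g = h"
    by (simp only: powr_inj)
qed

theorem theorem2:
  assumes "CARD('n::finite) \<ge> 2"
  shows "infinite {u :: real^'n \<Rightarrow> real^'n. is_solution u} \<and>
    (\<forall>\<gamma>::real. \<gamma> > -1 \<longrightarrow>
       (let u = (\<lambda>x::real^'n. if x = 0 then 0 else (norm x) powr \<gamma> *\<^sub>R x) in
          is_solution u \<and> diffeomorphism_onto punct_ball punct_ball u))"
proof (intro conjI allI impI)
  have "infinite (radial_power ` {-1<..} :: (real^'n \<Rightarrow> real^'n) set)"
    using finite_imageD[of radial_power] inj_on_subset[OF inj_radial_power] infinite_Ioi by blast
  then show "infinite {u :: real^'n \<Rightarrow> real^'n. is_solution u}"
    by (rule infinite_super[rotated]) (use assms is_solution_radial_power in auto)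
  fix \<gamma> :: real
  assume "\<gamma> > -1"
  \<comment> \<open>At the origin the vector factor makes \<open>radial_power\<close> vanish for
    every exponent, in agreement with the case distinction.\<close>
  moreover have "(\<lambda>x::real^'n. if x = 0 then 0 else norm x powr \<gamma> *\<^sub>R x) = radial_power \<gamma>"
    by (auto simp: radial_power_def)
  ultimately show "let u = (\<lambda>x::real^'n. if x = 0 then 0 else (norm x) powr \<gamma> *\<^sub>R x) in
      is_solution u \<and> diffeomorphism_onto punct_ball punct_ball u"
    using assms by (simp add: is_solution_radial_power diffeomorphism_radial_power)
qed

end
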